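(* Let $\mathcal{G}$ and $\mathbf{g}$ be dual deformations of the Lie group $SL(2)$ and the Lie algebra $sl(2)$, with $D$-functions $\mathcal{D}^{\,j}_{m',m}\in\mathcal{G}$ and universal $R$-matrix $\mathcal{R}$ of $\mathbf{g}$, as described in the context. Then for all spins $j_1,j_2$ and all $m_i,k_i\in\{-j_i,\dots,j_i\}$ ($i=1,2$), $$\sum_{s_1,s_2}(R^{j_1,j_2})^{s_1,s_2}_{m_1,m_2}\,\mathcal{D}^{\,j_1}_{s_1,k_1}\mathcal{D}^{\,j_2}_{s_2,k_2}=\sum_{s_1,s_2}\mathcal{D}^{\,j_2}_{m_2,s_2}\mathcal{D}^{\,j_1}_{m_1,s_1}\,(R^{j_1,j_2})^{k_1,k_2}_{s_1,s_2},$$ where $(R^{j_1,j_2})^{s_1,s_2}_{m_1,m_2}=\langle j_1m_1|\otimes\langle j_2m_2|\;\mathcal{R}\;|j_1s_1\rangle\otimes|j_2s_2\rangle$ are the matrix elements of the universal $R$-matrix, and $s_i$ runs over $\{-j_i,\dots,j_i\}$.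
   Context: Setting. $\mathcal{G}$ (a deformation of the function algebra of $SL(2)$) and $\mathbf{g}$ (a deformation of the enveloping algebra of $sl(2)$) are Hopf algebras in duality. There are bases $\{x^\alpha\}$ of $\mathcal{G}$ and $\{X_\alpha\}$ of $\mathbf{g}$ and structure constants $h^{\alpha,\beta}_\gamma$, $f^\gamma_{\alpha,\beta}$ such that $$x^\alpha x^\beta=\sum_\gamma h^{\alpha,\beta}_\gamma x^\gamma,\quad X_\alpha X_\beta=\sum_\gamma f^\gamma_{\alpha,\beta}X_\gamma,\quad \Delta(x^\alpha)=\sum_{\beta,\gamma}f^\alpha_{\beta,\gamma}\,x^\beta\otimes x^\gamma,\quad \Delta(X_\alpha)=\sum_{\beta,\gamma}h^{\beta,\gamma}_\alpha X_\beta\otimes X_\gamma .$$ The universal $T$-matrix is $\mathcal{T}=\sum_\alpha x^\alpha\otimes X_\alpha$ (sums over $\alpha$ are understood formally). $\mathbf{g}$ possesses a universal $R$-matrix: an invertible element $\mathcal{R}$ of (a completion of) $\mathbf{g}\otimes\mathbf{g}$ with $\mathcal{R}\,\Delta(X)\,\mathcal{R}^{-1}=\Delta'(X)$ for all $X\in\mathbf{g}$, where $\Delta'$ is the opposite coproduct. Assumptions on representations. $\mathbf{g}$ has the same finite dimensional highest weight irreducible representations as $sl(2)$: each is labelled by a spin $j\in\{0,\frac12,1,\dots\}$ with basis $|jm\rangle$, $m=-j,-j+1,\dots,j$, which is complete and orthonormal (with dual basis $\langle jm|$), and tensor products of irreducible representations decompose as for $sl(2)$. $D$-functions: $\mathcal{D}^{\,j}_{m',m}=\langle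 jm'|\mathcal{T}|jm\rangle=\sum_\alpha x^\alpha\,\langle jm'|X_\alpha|jm\rangle\in\mathcal{G}$. *)

theory Defs
  imports Complex_Main "HOL-Library.Groups_Big_Fun" "HOL-Library.Function_Algebras"
begin

section \<open>Algebras and finite-dimensional representations\<close>

locale k_algebra = vector_space scale
  for scale :: "'k::field \<Rightarrow> 'a::ring_1 \<Rightarrow> 'a" +
  assumes scale_mult_left: "scale c a * b = scale c (a * b)"
    and scale_mult_right: "a * scale c b = scale c (a * b)"

text \<open>
  The vector space with orthonormal basis \<open>|b\<rangle>\<close>, \<open>b \<in> B\<close>, is the space of functions supported on
  \<open>B\<close>. Then \<open>ket b\<close> is the basis vector \<open>|b\<rangle>\<close>, and the dual basis vector \<open>\<langle>b|\<close> is evaluation at \<open>b\<close>.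
\<close>

definition coord_space :: "'b set \<Rightarrow> ('b \<Rightarrow> 'k::field) set" where
  "coord_space B = {v. \<forall>b. b \<notin> B \<longrightarrow> v b = 0}"

definition fscale :: "'k::field \<Rightarrow> ('b \<Rightarrow> 'k) \<Rightarrow> 'b \<Rightarrow> 'k" where
  "fscale c v = (\<lambda>b. c * v b)"

definition ket :: "'b \<Rightarrow> 'b \<Rightarrow> 'k::field" where
  "ket b = (\<lambda>b'. if b' = b then 1 else 0)"

definition matrix_element ::
    "('a \<Rightarrow> ('b \<Rightarrow> 'k::field) \<Rightarrow> 'b \<Rightarrow> 'k) \<Rightarrow> 'b \<Rightarrow> 'a \<Rightarrow> 'b \<Rightarrow> 'k" where
  "matrix_element \<pi> b' a b = \<pi> a (ket b) b'"

definition vtensor :: "('b \<Rightarrow> 'k::field) \<Rightarrow> ('d \<Rightarrow> 'k) \<Rightarrow> 'b \<times> 'd \<Rightarrow> 'k" where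
  "vtensor v w = (\<lambda>(b, d). v b * w d)"

locale fin_rep = k_algebra scale
  for scale :: "'k::field \<Rightarrow> 'a::ring_1 \<Rightarrow> 'a" +
  fixes B :: "'b set" and \<pi> :: "'a \<Rightarrow> ('b \<Rightarrow> 'k) \<Rightarrow> 'b \<Rightarrow> 'k"
  assumes finite_basis: "finite B"
    and closed: "v \<in> coord_space B \<Longrightarrow> \<pi> a v \<in> coord_space B"
    and vec_add: "v \<in> coord_space B \<Longrightarrow> w \<in> coord_space B \<Longrightarrow> \<pi> a (v + w) = \<pi> a v + \<pi> a w"
    and vec_scale: "v \<in> coord_space B \<Longrightarrow> \<pi> a (fscale c v) = fscale c (\<pi> a v)"
    and alg_add: "v \<in> coord_space B \<Longrightarrow> \<pi> (a + b) v = \<pi> a v + \<pi> b v"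
    and alg_scale: "v \<in> coord_space B \<Longrightarrow> \<pi> (scale c a) v = fscale c (\<pi> a v)"
    and alg_one: "v \<in> coord_space B \<Longrightarrow> \<pi> 1 v = v"
    and alg_mult: "v \<in> coord_space B \<Longrightarrow> \<pi> (a * b) v = \<pi> a (\<pi> b v)"

definition irreducible_rep :: "'b set \<Rightarrow> ('a \<Rightarrow> ('b \<Rightarrow> 'k::field) \<Rightarrow> 'b \<Rightarrow> 'k) \<Rightarrow> bool" where
  "irreducible_rep B \<pi> \<longleftrightarrow> B \<noteq> {} \<and>
     (\<forall>W. W \<subseteq> coord_space B \<and> module.subspace fscale W \<and> (\<forall>a. \<forall>w\<in>W. \<pi> a w \<in> W)
        \<longrightarrow> W = {0} \<or> W = coord_space B)"

definition equivalent_reps ::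
    "'b set \<Rightarrow> ('a \<Rightarrow> ('b \<Rightarrow> 'k::field) \<Rightarrow> 'b \<Rightarrow> 'k) \<Rightarrow>
     'd set \<Rightarrow> ('a \<Rightarrow> ('d \<Rightarrow> 'k) \<Rightarrow> 'd \<Rightarrow> 'k) \<Rightarrow> bool" where
  "equivalent_reps B \<pi> B' \<pi>' \<longleftrightarrow>
     (\<exists>T. bij_betw T (coord_space B) (coord_space B') \<and>
          (\<forall>v\<in>coord_space B. \<forall>w\<in>coord_space B. T (v + w) = T v + T w) \<and>
          (\<forall>c. \<forall>v\<in>coord_space B. T (fscale c v) = fscale c (T v)) \<and>
          (\<forall>a. \<forall>v\<in>coord_space B. T (\<pi> a v) = \<pi>' a (T v)))"

text \<open>The direct sum over \<open>j \<in> J\<close> acts on the functions supported on \<open>Sigma J B\<close>.\<close>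

definition direct_sum_rep ::
    "'j set \<Rightarrow> ('j \<Rightarrow> 'a \<Rightarrow> ('b \<Rightarrow> 'k::field) \<Rightarrow> 'b \<Rightarrow> 'k) \<Rightarrow> 'a \<Rightarrow> ('j \<times> 'b \<Rightarrow> 'k) \<Rightarrow> 'j \<times> 'b \<Rightarrow> 'k" where
  "direct_sum_rep J \<pi> a v = (\<lambda>(j, b). if j \<in> J then \<pi> j a (\<lambda>b'. v (j, b')) b else 0)"


section \<open>Hopf algebras in duality\<close>

text \<open>
  The Hopf algebra \<open>g\<close>, of type \<open>'u\<close>, with basis \<open>X \<alpha>\<close>. The structure constants are
  \<open>f \<alpha> \<beta> \<gamma>\<close> (two lower indices, upper index \<open>\<gamma>\<close>) and \<open>h \<alpha> \<beta> \<gamma>\<close> (two upper indices, lower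
  index \<open>\<gamma>\<close>). The type \<open>'c\<close> is an arbitrary algebra containing \<open>g \<otimes> g\<close>, which is spanned by the
  elements \<open>tens a b\<close> = \<open>a \<otimes> b\<close>; it is the completion in which the universal R-matrix lives.
  \<open>Sum_any\<close> is the sum of a finitely supported family.

  Coassociativity is the equality of the coefficients of \<open>X \<beta> \<otimes> X \<gamma> \<otimes> X \<delta>\<close> in
  \<open>(\<Delta> \<otimes> id) \<Delta> (X \<alpha>)\<close> and \<open>(id \<otimes> \<Delta>) \<Delta> (X \<alpha>)\<close>.
\<close>

locale hopf_algebra_with_basis = U: k_algebra scaleU + C: k_algebra scaleC
  for scaleU :: "'k::field \<Rightarrow> 'u::ring_1 \<Rightarrow> 'u"
    and scaleC :: "'k \<Rightarrow> 'c::ring_1 \<Rightarrow> 'c" +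
  fixes X :: "'i \<Rightarrow> 'u"
    and f h :: "'i \<Rightarrow> 'i \<Rightarrow> 'i \<Rightarrow> 'k"
    and tens :: "'u \<Rightarrow> 'u \<Rightarrow> 'c"
    and \<Delta> :: "'u \<Rightarrow> 'c"
    and \<epsilon> :: "'u \<Rightarrow> 'k"
    and S :: "'u \<Rightarrow> 'u"
  assumes X_inj: "inj X"
    and X_independent: "\<not> U.dependent (range X)"
    and X_span: "U.span (range X) = UNIV"
    and f_finite: "finite {\<gamma>. f \<alpha> \<beta> \<gamma> \<noteq> 0}"
    and X_mult: "X \<alpha> * X \<beta> = Sum_any (\<lambda>\<gamma>. scaleU (f \<alpha> \<beta> \<gamma>) (X \<gamma>))"
    and tens_linear_left: "Vector_Spaces.linear scaleU scaleC (\<lambda>a. tens a b)"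
    and tens_linear_right: "Vector_Spaces.linear scaleU scaleC (\<lambda>b. tens a b)"
    and tens_one: "tens 1 1 = 1"
    and tens_mult: "tens a b * tens a' b' = tens (a * a') (b * b')"
    and tens_inj: "inj (\<lambda>(\<alpha>, \<beta>). tens (X \<alpha>) (X \<beta>))"
    and tens_independent: "\<not> C.dependent (range (\<lambda>(\<alpha>, \<beta>). tens (X \<alpha>) (X \<beta>)))"
    and \<Delta>_linear: "Vector_Spaces.linear scaleU scaleC \<Delta>"
    and \<Delta>_one: "\<Delta> 1 = 1"
    and \<Delta>_mult: "\<Delta> (a * b) = \<Delta> a * \<Delta> b"
    and h_finite: "finite {(\<beta>, \<gamma>). h \<beta> \<gamma> \<alpha> \<noteq> 0}"
    and \<Delta>_X: "\<Delta> (X \<alpha>) = Sum_any (\<lambda>(\<beta>, \<gamma>). scaleC (h \<beta> \<gamma> \<alpha>) (tens (X \<beta>) (X \<gamma>)))"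
    and coassoc: "Sum_any (\<lambda>\<nu>. h \<nu> \<delta> \<alpha> * h \<beta> \<gamma> \<nu>) = Sum_any (\<lambda>\<nu>. h \<beta> \<nu> \<alpha> * h \<gamma> \<delta> \<nu>)"
    and \<epsilon>_linear: "Vector_Spaces.linear scaleU (*) \<epsilon>"
    and \<epsilon>_one: "\<epsilon> 1 = 1"
    and \<epsilon>_mult: "\<epsilon> (a * b) = \<epsilon> a * \<epsilon> b"
    and counit_left: "Sum_any (\<lambda>(\<beta>, \<gamma>). scaleU (h \<beta> \<gamma> \<alpha> * \<epsilon> (X \<beta>)) (X \<gamma>)) = X \<alpha>"
    and counit_right: "Sum_any (\<lambda>(\<beta>, \<gamma>). scaleU (h \<beta> \<gamma> \<alpha> * \<epsilon> (X \<gamma>)) (X \<beta>)) = X \<alpha>"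
    and S_linear: "Vector_Spaces.linear scaleU scaleU S"
    and antipode_left:
      "Sum_any (\<lambda>(\<beta>, \<gamma>). scaleU (h \<beta> \<gamma> \<alpha>) (S (X \<beta>) * X \<gamma>)) = scaleU (\<epsilon> (X \<alpha>)) 1"
    and antipode_right:
      "Sum_any (\<lambda>(\<beta>, \<gamma>). scaleU (h \<beta> \<gamma> \<alpha>) (X \<beta> * S (X \<gamma>))) = scaleU (\<epsilon> (X \<alpha>)) 1"

text \<open>The coefficient of \<open>X \<alpha>\<close> in \<open>u\<close>.\<close>

definition basis_coeff ::
    "('k::field \<Rightarrow> 'u::ring_1 \<Rightarrow> 'u) \<Rightarrow> ('i \<Rightarrow> 'u) \<Rightarrow> 'u \<Rightarrow> 'i \<Rightarrow> 'k" where
  "basis_coeff scaleU X u \<alpha> = module.representation scaleU (range X) u (X \<alpha>)"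

text \<open>
  The opposite coproduct: the linear map sending \<open>X \<alpha>\<close> to the sum over \<open>\<beta>, \<gamma>\<close> of
  \<open>h \<beta> \<gamma> \<alpha>\<close> times \<open>X \<gamma> \<otimes> X \<beta>\<close>.
\<close>

definition opposite_coproduct ::
    "('k::field \<Rightarrow> 'u::ring_1 \<Rightarrow> 'u) \<Rightarrow> ('k \<Rightarrow> 'c::ring_1 \<Rightarrow> 'c) \<Rightarrow> ('i \<Rightarrow> 'u) \<Rightarrow>
     ('i \<Rightarrow> 'i \<Rightarrow> 'i \<Rightarrow> 'k) \<Rightarrow> ('u \<Rightarrow> 'u \<Rightarrow> 'c) \<Rightarrow> 'u \<Rightarrow> 'c" where
  "opposite_coproduct scaleU scaleC X h tens u =
     Sum_any (\<lambda>\<alpha>. scaleC (basis_coeff scaleU X u \<alpha>)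
       (Sum_any (\<lambda>(\<beta>, \<gamma>). scaleC (h \<beta> \<gamma> \<alpha>) (tens (X \<gamma>) (X \<beta>)))))"

text \<open>
  Elements \<open>a\<close> of \<open>G\<close> are (finite or infinite) formal sums over the \<open>x \<alpha>\<close>, and \<open>coeff a \<alpha>\<close> is the
  coefficient of \<open>x \<alpha>\<close> in \<open>a\<close>. A family \<open>F\<close> has the formal sum \<open>a\<close> if every coefficient involves
  only finitely many members of \<open>F\<close> and the coefficients add up to those of \<open>a\<close>.
\<close>

definition has_formal_sum :: "('g \<Rightarrow> 'i \<Rightarrow> 'k::field) \<Rightarrow> ('j \<Rightarrow> 'g) \<Rightarrow> 'g \<Rightarrow> bool" where
  "has_formal_sum coeff F a \<longleftrightarrow>
     (\<forall>\<gamma>. finite {i. coeff (F i) \<gamma> \<noteq> 0} \<and> coeff a \<gamma> = Sum_any (\<lambda>i. coeff (F i) \<gamma>))"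

definition formal_sum :: "('g \<Rightarrow> 'i \<Rightarrow> 'k::field) \<Rightarrow> ('j \<Rightarrow> 'g) \<Rightarrow> 'g" where
  "formal_sum coeff F = (THE a. has_formal_sum coeff F a)"

text \<open>The pairing of \<open>G\<close> and \<open>g\<close> for which \<open>x \<alpha>\<close> and \<open>X \<alpha>\<close> are dual bases.\<close>

definition pairing ::
    "('k::field \<Rightarrow> 'u::ring_1 \<Rightarrow> 'u) \<Rightarrow> ('i \<Rightarrow> 'u) \<Rightarrow> ('g \<Rightarrow> 'i \<Rightarrow> 'k) \<Rightarrow> 'g \<Rightarrow> 'u \<Rightarrow> 'k" where
  "pairing scaleU X coeff a u = Sum_any (\<lambda>\<alpha>. coeff a \<alpha> * basis_coeff scaleU X u \<alpha>)"

text \<open>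
  The dual Hopf algebra \<open>G\<close>, of type \<open>'g\<close>. It may consist of finite sums only or contain any
  infinite formal sums; multiplication and coproduct are extended to the latter term by term
  (the sums are locally finite because of the finite support of \<open>f\<close> and \<open>h\<close>).
  The coproduct is a formal sum as well: \<open>\<Delta>G a \<beta> \<gamma>\<close> is the coefficient of \<open>x \<beta> \<otimes> x \<gamma>\<close>
  in the coproduct of \<open>a\<close>. The Hopf algebra axioms for \<open>\<Delta>G\<close>, \<open>\<epsilon>G\<close> and \<open>SG\<close> are dual to those
  of \<open>g\<close> and need not be repeated.
\<close>

locale hopf_algebras_in_duality =
  hopf_algebra_with_basis scaleU scaleC X f h tens \<Delta> \<epsilon> S + G: k_algebra scaleG
  for scaleU :: "'k::field \<Rightarrow> 'u::ring_1 \<Rightarrow> 'u"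
    and scaleC :: "'k \<Rightarrow> 'c::ring_1 \<Rightarrow> 'c"
    and X :: "'i \<Rightarrow> 'u"
    and f h :: "'i \<Rightarrow> 'i \<Rightarrow> 'i \<Rightarrow> 'k"
    and tens :: "'u \<Rightarrow> 'u \<Rightarrow> 'c"
    and \<Delta> :: "'u \<Rightarrow> 'c"
    and \<epsilon> :: "'u \<Rightarrow> 'k"
    and S :: "'u \<Rightarrow> 'u"
    and scaleG :: "'k \<Rightarrow> 'g::ring_1 \<Rightarrow> 'g" +
  fixes x :: "'i \<Rightarrow> 'g"
    and coeff :: "'g \<Rightarrow> 'i \<Rightarrow> 'k"
    and \<Delta>G :: "'g \<Rightarrow> 'i \<Rightarrow> 'i \<Rightarrow> 'k"
    and \<epsilon>G :: "'g \<Rightarrow> 'k"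
    and SG :: "'g \<Rightarrow> 'g"
  assumes coeff_add: "coeff (a + b) \<alpha> = coeff a \<alpha> + coeff b \<alpha>"
    and coeff_scale: "coeff (scaleG c a) \<alpha> = c * coeff a \<alpha>"
    and coeff_inj: "inj coeff"
    and coeff_x: "coeff (x \<alpha>) \<beta> = (if \<alpha> = \<beta> then 1 else 0)"
    and x_mult: "has_formal_sum coeff (\<lambda>\<gamma>. scaleG (h \<alpha> \<beta> \<gamma>) (x \<gamma>)) (x \<alpha> * x \<beta>)"
    and mult_formal:
      "has_formal_sum coeff (\<lambda>(\<alpha>, \<beta>). scaleG (coeff a \<alpha> * coeff b \<beta>) (x \<alpha> * x \<beta>)) (a * b)"
    and \<Delta>G_x: "\<Delta>G (x \<alpha>) \<beta> \<gamma> = f \<beta> \<gamma> \<alpha>"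
    and \<Delta>G_formal: "\<Delta>G a \<beta> \<gamma> = Sum_any (\<lambda>\<alpha>. coeff a \<alpha> * \<Delta>G (x \<alpha>) \<beta> \<gamma>)"
    and dual_unit: "pairing scaleU X coeff 1 u = \<epsilon> u"
    and dual_counit: "\<epsilon>G a = pairing scaleU X coeff a 1"
    and dual_antipode: "pairing scaleU X coeff (SG a) u = pairing scaleU X coeff a (S u)"


section \<open>Representations of spin \<open>j\<close>, R-matrix and D-functions\<close>

definition spins :: "rat set" where
  "spins = {j. \<exists>n::nat. j = of_nat n / 2}"

definition weights :: "rat \<Rightarrow> rat set" where
  "weights j = {m. \<exists>n::nat. m = - j + of_nat n \<and> m \<le> j}"

definition coupled_spins :: "rat \<Rightarrow> rat \<Rightarrow> rat set" where
  "coupled_spins j1 j2 = {j. \<exists>n::nat. j = \<bar>j1 - j2\<bar> + of_nat n \<and> j \<le> j1 + j2}"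

text \<open>
  \<open>\<pi> j\<close> is the irreducible representation of spin \<open>j\<close>. \<open>\<Pi> j1 j2\<close> is the extension of the
  representation \<open>\<pi> j1 \<otimes> \<pi> j2\<close> of \<open>g \<otimes> g\<close> to the completion \<open>'c\<close>; it gives a meaning to the
  matrix elements of the R-matrix. Its composition with \<open>\<Delta>\<close> is the tensor product representation
  of \<open>g\<close>.
\<close>

locale spin_representations =
  fixes scaleU :: "'k::field \<Rightarrow> 'u::ring_1 \<Rightarrow> 'u"
    and scaleC :: "'k \<Rightarrow> 'c::ring_1 \<Rightarrow> 'c"
    and tens :: "'u \<Rightarrow> 'u \<Rightarrow> 'c"
    and \<Delta> :: "'u \<Rightarrow> 'c"
    and \<pi> :: "rat \<Rightarrow> 'u \<Rightarrow> (rat \<Rightarrow> 'k) \<Rightarrow> rat \<Rightarrow> 'k"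
    and \<Pi> :: "rat \<Rightarrow> rat \<Rightarrow> 'c \<Rightarrow> (rat \<times> rat \<Rightarrow> 'k) \<Rightarrow> rat \<times> rat \<Rightarrow> 'k"
  assumes rep: "j \<in> spins \<Longrightarrow> fin_rep scaleU (weights j) (\<pi> j)"
    and irreducible: "j \<in> spins \<Longrightarrow> irreducible_rep (weights j) (\<pi> j)"
    and rep_tensor: "j1 \<in> spins \<Longrightarrow> j2 \<in> spins \<Longrightarrow>
      fin_rep scaleC (weights j1 \<times> weights j2) (\<Pi> j1 j2)"
    and rep_tens: "j1 \<in> spins \<Longrightarrow> j2 \<in> spins \<Longrightarrow>
      v \<in> coord_space (weights j1) \<Longrightarrow> w \<in> coord_space (weights j2) \<Longrightarrow>
      \<Pi> j1 j2 (tens a b) (vtensor v w) = vtensor (\<pi> j1 a v) (\<pi> j2 b w)"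
    and decomposition: "j1 \<in> spins \<Longrightarrow> j2 \<in> spins \<Longrightarrow>
      equivalent_reps (weights j1 \<times> weights j2) (\<lambda>a. \<Pi> j1 j2 (\<Delta> a))
        (Sigma (coupled_spins j1 j2) weights) (direct_sum_rep (coupled_spins j1 j2) \<pi>)"

definition universal_R_matrix ::
    "('k::field \<Rightarrow> 'u::ring_1 \<Rightarrow> 'u) \<Rightarrow> ('k \<Rightarrow> 'c::ring_1 \<Rightarrow> 'c) \<Rightarrow> ('i \<Rightarrow> 'u) \<Rightarrow>
     ('i \<Rightarrow> 'i \<Rightarrow> 'i \<Rightarrow> 'k) \<Rightarrow> ('u \<Rightarrow> 'u \<Rightarrow> 'c) \<Rightarrow> ('u \<Rightarrow> 'c) \<Rightarrow> 'c \<Rightarrow> bool" where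
  "universal_R_matrix scaleU scaleC X h tens \<Delta> R \<longleftrightarrow>
     (\<exists>R'. R * R' = 1 \<and> R' * R = 1 \<and>
       (\<forall>u. R * \<Delta> u * R' = opposite_coproduct scaleU scaleC X h tens u))"

text \<open>\<open>R_matrix \<Pi> R j1 j2 m1 m2 s1 s2\<close> has lower indices \<open>m1, m2\<close> and upper indices \<open>s1, s2\<close>.\<close>

definition R_matrix ::
    "(rat \<Rightarrow> rat \<Rightarrow> 'c \<Rightarrow> (rat \<times> rat \<Rightarrow> 'k::field) \<Rightarrow> rat \<times> rat \<Rightarrow> 'k) \<Rightarrow> 'c \<Rightarrow>
     rat \<Rightarrow> rat \<Rightarrow> rat \<Rightarrow> rat \<Rightarrow> rat \<Rightarrow> rat \<Rightarrow> 'k" where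
  "R_matrix \<Pi> R j1 j2 m1 m2 s1 s2 = matrix_element (\<Pi> j1 j2) (m1, m2) R (s1, s2)"

text \<open>
  The matrix element \<open>\<langle>j m'| T |j m\<rangle>\<close> of the universal T-matrix (the formal sum of the
  \<open>x \<alpha> \<otimes> X \<alpha>\<close>) is the formal sum of the family \<open>D_terms\<close>.
\<close>

definition D_terms ::
    "('k::field \<Rightarrow> 'g \<Rightarrow> 'g) \<Rightarrow> ('i \<Rightarrow> 'g) \<Rightarrow> ('i \<Rightarrow> 'u) \<Rightarrow>
     (rat \<Rightarrow> 'u \<Rightarrow> (rat \<Rightarrow> 'k) \<Rightarrow> rat \<Rightarrow> 'k) \<Rightarrow> rat \<Rightarrow> rat \<Rightarrow> rat \<Rightarrow> 'i \<Rightarrow> 'g" where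
  "D_terms scaleG x X \<pi> j m' m \<alpha> = scaleG (matrix_element (\<pi> j) m' (X \<alpha>) m) (x \<alpha>)"

definition D_function ::
    "('k::field \<Rightarrow> 'g \<Rightarrow> 'g) \<Rightarrow> ('g \<Rightarrow> 'i \<Rightarrow> 'k) \<Rightarrow> ('i \<Rightarrow> 'g) \<Rightarrow> ('i \<Rightarrow> 'u) \<Rightarrow>
     (rat \<Rightarrow> 'u \<Rightarrow> (rat \<Rightarrow> 'k) \<Rightarrow> rat \<Rightarrow> 'k) \<Rightarrow> rat \<Rightarrow> rat \<Rightarrow> rat \<Rightarrow> 'g" where
  "D_function scaleG coeff x X \<pi> j m' m = formal_sum coeff (D_terms scaleG x X \<pi> j m' m)"

end

theory Submission
  imports Defs
begin

text \<open>
  Both sides of the identity are elements of \<open>G\<close>, so it suffices to compare their coefficients at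
  each \<open>x \<gamma>\<close>. The coefficient of a product of two \<open>D\<close>-functions at \<open>x \<gamma>\<close> is the sum of
  \<open>h \<alpha> \<beta> \<gamma>\<close> times a matrix element of \<open>X \<alpha>\<close> times a matrix element of \<open>X \<beta>\<close>. Since \<open>h\<close> also
  gives the coproduct of \<open>g\<close>, this is a matrix element of \<open>\<Delta> (X \<gamma>)\<close> when the factor of
  spin \<open>j1\<close> comes first (\<open>coeff_D_mult\<close>), and of the opposite coproduct \<open>\<Delta>'(X \<gamma>)\<close> when the
  factor of spin \<open>j2\<close> comes first (\<open>coeff_D_mult_swapped\<close>), both in the representation
  \<open>\<Pi> j1 j2\<close>.

  Summation over the intermediate weights is matrix multiplication (\<open>matrix_element_mult\<close>).
  Hence the two sides have the coefficients \<open>\<langle>m1 m2| R \<Delta>(X \<gamma>) |k1 k2\<rangle>\<close> and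
  \<open>\<langle>m1 m2| \<Delta>'(X \<gamma>) R |k1 k2\<rangle>\<close>, and these agree because \<open>R\<close> intertwines \<open>\<Delta>\<close> and \<open>\<Delta>'\<close>.
\<close>

section \<open>Matrix elements of representations\<close>

lemma ket_in_coord_space: "b \<in> B \<Longrightarrow> ket b \<in> coord_space B"
  by (auto simp: coord_space_def ket_def)

lemma vtensor_ket: "vtensor (ket b) (ket d) = ket (b, d)"
  by (auto simp: vtensor_def ket_def fun_eq_iff)

lemma coord_space_sum:
  assumes "\<And>i. i \<in> A \<Longrightarrow> v i \<in> coord_space B"
  shows "sum v A \<in> coord_space B"
  using assms
  by (induction A rule: infinite_finite_induct) (auto simp: coord_space_def)

lemma coord_space_fscale: "v \<in> coord_space B \<Longrightarrow> fscale c v \<in> coord_space B"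
  by (auto simp: coord_space_def fscale_def)

lemma sum_fun_apply: "sum v A b = (\<Sum>i\<in>A. v i b)"
  by (induction A rule: infinite_finite_induct) auto

lemma ket_expansion:
  assumes "finite B" "v \<in> coord_space B"
  shows "v = (\<Sum>s\<in>B. fscale (v s) (ket s))"
proof
  fix b
  have "(\<Sum>s\<in>B. v s * (if b = s then 1 else 0)) = v b"
    using assms by (auto simp: coord_space_def if_distrib cong: if_cong)
  then show "v b = (\<Sum>s\<in>B. fscale (v s) (ket s)) b"
    by (simp add: sum_fun_apply fscale_def ket_def)
qed

context fin_rep
begin

lemma rep_zero_vec: "\<pi> a 0 = 0"
proof -
  have "\<pi> a (0 + 0) = \<pi> a 0 + \<pi> a 0"
    by (rule vec_add) (auto simp: coord_space_def)
  then show ?thesis by simp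
qed

lemma rep_zero_alg: "v \<in> coord_space B \<Longrightarrow> \<pi> 0 v = 0"
  using alg_add[of v 0 0] by simp

lemma rep_sum_vec:
  assumes "\<And>i. i \<in> A \<Longrightarrow> v i \<in> coord_space B"
  shows "\<pi> a (\<Sum>i\<in>A. fscale (c i) (v i)) = (\<Sum>i\<in>A. fscale (c i) (\<pi> a (v i)))"
  using assms
  by (induction A rule: infinite_finite_induct)
     (simp_all add: rep_zero_vec vec_add vec_scale coord_space_sum coord_space_fscale)

lemma matrix_element_sum:
  assumes "b \<in> B"
  shows "matrix_element \<pi> b' (\<Sum>i\<in>A. scale (c i) (a i)) b =
    (\<Sum>i\<in>A. c i * matrix_element \<pi> b' (a i) b)"
proof -
  note ket = ket_in_coord_space[OF assms]
  show ?thesis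
    unfolding matrix_element_def
    by (induction A rule: infinite_finite_induct)
       (simp_all add: rep_zero_alg[OF ket] alg_add[OF ket] alg_scale[OF ket] fscale_def)
qed

text \<open>The completeness relation: the sum over \<open>s\<close> of \<open>|s\<rangle>\<langle>s|\<close> is the identity.\<close>

lemma matrix_element_mult:
  assumes "b \<in> B"
  shows "matrix_element \<pi> b' (a * a') b =
    (\<Sum>s\<in>B. matrix_element \<pi> b' a s * matrix_element \<pi> s a' b)"
proof -
  let ?v = "\<pi> a' (ket b)"
  have "?v \<in> coord_space B"
    using assms by (intro closed ket_in_coord_space)
  then have "\<pi> a ?v = \<pi> a (\<Sum>s\<in>B. fscale (?v s) (ket s))"
    using ket_expansion[OF finite_basis] by metis
  also have "\<dots> = (\<Sum>s\<in>B. fscale (?v s) (\<pi> a (ket s)))"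
    by (intro rep_sum_vec ket_in_coord_space)
  finally have "\<pi> a ?v b' = (\<Sum>s\<in>B. ?v s * \<pi> a (ket s) b')"
    by (simp add: sum_fun_apply fscale_def)
  then show ?thesis
    using alg_mult[OF ket_in_coord_space[OF assms]]
    by (simp add: matrix_element_def mult.commute)
qed

end

section \<open>The coproduct and its opposite in the basis\<close>

context hopf_algebra_with_basis
begin

lemma \<Delta>_basis:
  "\<Delta> (X \<gamma>) = (\<Sum>(\<alpha>, \<beta>)\<in>{(\<alpha>, \<beta>). h \<alpha> \<beta> \<gamma> \<noteq> 0}. scaleC (h \<alpha> \<beta> \<gamma>) (tens (X \<alpha>) (X \<beta>)))"
  unfolding \<Delta>_X by (rule Sum_any.expand_superset) (use h_finite in auto)

lemma opposite_coproduct_basis: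
  "opposite_coproduct scaleU scaleC X h tens (X \<gamma>) =
    (\<Sum>(\<alpha>, \<beta>)\<in>{(\<alpha>, \<beta>). h \<alpha> \<beta> \<gamma> \<noteq> 0}. scaleC (h \<alpha> \<beta> \<gamma>) (tens (X \<beta>) (X \<alpha>)))"
proof -
  have coeff: "basis_coeff scaleU X (X \<gamma>) \<alpha> = (if \<alpha> = \<gamma> then 1 else 0)" for \<alpha>
    using X_independent X_inj
    by (auto simp: basis_coeff_def U.representation_basis inj_eq)
  let ?T = "\<lambda>\<delta>. Sum_any (\<lambda>(\<alpha>, \<beta>). scaleC (h \<alpha> \<beta> \<delta>) (tens (X \<beta>) (X \<alpha>)))"
  have "opposite_coproduct scaleU scaleC X h tens (X \<gamma>) =
      (\<Sum>\<delta>\<in>{\<gamma>}. scaleC (basis_coeff scaleU X (X \<gamma>) \<delta>) (?T \<delta>))"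
    unfolding opposite_coproduct_def
    by (rule Sum_any.expand_superset) (auto simp: coeff split: if_splits)
  also have "\<dots> = ?T \<gamma>"
    by (simp add: coeff)
  also have "\<dots> = (\<Sum>(\<alpha>, \<beta>)\<in>{(\<alpha>, \<beta>). h \<alpha> \<beta> \<gamma> \<noteq> 0}. scaleC (h \<alpha> \<beta> \<gamma>) (tens (X \<beta>) (X \<alpha>)))"
    by (rule Sum_any.expand_superset) (use h_finite in auto)
  finally show ?thesis .
qed

end

lemma universal_R_matrix_intertwines:
  assumes "universal_R_matrix scaleU scaleC X h tens \<Delta> R"
  shows "R * \<Delta> u = opposite_coproduct scaleU scaleC X h tens u * R"
proof -
  obtain R' where "R' * R = 1"
    and "R * \<Delta> u * R' = opposite_coproduct scaleU scaleC X h tens u"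
    using assms unfolding universal_R_matrix_def by blast
  then show ?thesis
    by (metis mult.assoc mult.right_neutral)
qed

section \<open>Products of D-functions\<close>

lemma (in spin_representations) matrix_element_tens:
  assumes "j1 \<in> spins" "j2 \<in> spins" "k1 \<in> weights j1" "k2 \<in> weights j2"
  shows "matrix_element (\<Pi> j1 j2) (m1, m2) (tens a b) (k1, k2) =
    matrix_element (\<pi> j1) m1 a k1 * matrix_element (\<pi> j2) m2 b k2"
  using rep_tens[OF assms(1,2) assms(3,4)[THEN ket_in_coord_space], of a b]
  unfolding matrix_element_def vtensor_ket by (simp add: vtensor_def)

context hopf_algebras_in_duality
begin

lemma coeff_sum: "coeff (\<Sum>i\<in>A. scaleG (c i) (a i)) \<gamma> = (\<Sum>i\<in>A. c i * coeff (a i) \<gamma>)"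
proof -
  have "coeff 0 \<gamma> = 0"
    using coeff_scale[of 0 0 \<gamma>] by simp
  then show ?thesis
    by (induction A rule: infinite_finite_induct) (auto simp: coeff_add coeff_scale)
qed

text \<open>An element is determined by its coefficients, so a family has at most one formal sum.\<close>

lemma coeff_formal_sum:
  assumes "has_formal_sum coeff F a"
  shows "coeff (formal_sum coeff F) \<gamma> = Sum_any (\<lambda>i. coeff (F i) \<gamma>)"
proof -
  have "formal_sum coeff F = a"
    unfolding formal_sum_def
  proof (rule the_equality)
    show "has_formal_sum coeff F a" by (rule assms)
  next
    fix b assume "has_formal_sum coeff F b"
    with assms have "coeff b = coeff a"
      by (auto simp: has_formal_sum_def)
    then show "b = a" by (rule injD[OF coeff_inj])
  qed
  with assms show ?thesis by (simp add: has_formal_sum_def)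
qed

lemma Sum_any_coeff_scale_x: "Sum_any (\<lambda>\<alpha>. coeff (scaleG (c \<alpha>) (x \<alpha>)) \<gamma>) = c \<gamma>"
proof -
  have "Sum_any (\<lambda>\<alpha>. coeff (scaleG (c \<alpha>) (x \<alpha>)) \<gamma>) = (\<Sum>\<alpha>\<in>{\<gamma>}. coeff (scaleG (c \<alpha>) (x \<alpha>)) \<gamma>)"
    by (rule Sum_any.expand_superset) (auto simp: coeff_scale coeff_x split: if_splits)
  then show ?thesis by (simp add: coeff_scale coeff_x)
qed

lemma coeff_x_mult: "coeff (x \<alpha> * x \<beta>) \<gamma> = h \<alpha> \<beta> \<gamma>"
  using x_mult[of \<alpha> \<beta>] by (simp add: has_formal_sum_def Sum_any_coeff_scale_x)

lemma coeff_mult: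
  "coeff (a * b) \<gamma> =
    (\<Sum>(\<alpha>, \<beta>)\<in>{(\<alpha>, \<beta>). h \<alpha> \<beta> \<gamma> \<noteq> 0}. h \<alpha> \<beta> \<gamma> * (coeff a \<alpha> * coeff b \<beta>))"
proof -
  have "coeff (a * b) \<gamma> = Sum_any (\<lambda>(\<alpha>, \<beta>). h \<alpha> \<beta> \<gamma> * (coeff a \<alpha> * coeff b \<beta>))"
    using mult_formal[of a b]
    by (simp add: has_formal_sum_def coeff_scale coeff_x_mult case_prod_beta mult.commute)
  also have "\<dots> = (\<Sum>(\<alpha>, \<beta>)\<in>{(\<alpha>, \<beta>). h \<alpha> \<beta> \<gamma> \<noteq> 0}. h \<alpha> \<beta> \<gamma> * (coeff a \<alpha> * coeff b \<beta>))"
    by (rule Sum_any.expand_superset) (use h_finite in auto)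
  finally show ?thesis .
qed

text \<open>
  This turns statements about the formal sums in \<open>G\<close> into statements about matrix elements of \<open>g\<close>.
\<close>

lemma coeff_D_function:
  assumes "\<exists>a. has_formal_sum coeff (D_terms scaleG x X \<pi> j m' m) a"
  shows "coeff (D_function scaleG coeff x X \<pi> j m' m) \<gamma> = matrix_element (\<pi> j) m' (X \<gamma>) m"
  using assms
  by (auto simp: D_function_def coeff_formal_sum D_terms_def Sum_any_coeff_scale_x)

end

locale spin_representations_in_duality =
  hopf_algebras_in_duality scaleU scaleC X f h tens \<Delta> \<epsilon> S scaleG x coeff \<Delta>G \<epsilon>G SG +
  spin_representations scaleU scaleC tens \<Delta> \<pi> \<Pi>
  for scaleU :: "'k::field \<Rightarrow> 'u::ring_1 \<Rightarrow> 'u"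
    and scaleC :: "'k \<Rightarrow> 'c::ring_1 \<Rightarrow> 'c"
    and X :: "'i \<Rightarrow> 'u"
    and f h :: "'i \<Rightarrow> 'i \<Rightarrow> 'i \<Rightarrow> 'k"
    and tens :: "'u \<Rightarrow> 'u \<Rightarrow> 'c"
    and \<Delta> :: "'u \<Rightarrow> 'c" and \<epsilon> :: "'u \<Rightarrow> 'k" and S :: "'u \<Rightarrow> 'u"
    and scaleG :: "'k \<Rightarrow> 'g::ring_1 \<Rightarrow> 'g"
    and x :: "'i \<Rightarrow> 'g" and coeff :: "'g \<Rightarrow> 'i \<Rightarrow> 'k"
    and \<Delta>G :: "'g \<Rightarrow> 'i \<Rightarrow> 'i \<Rightarrow> 'k" and \<epsilon>G :: "'g \<Rightarrow> 'k" and SG :: "'g \<Rightarrow> 'g"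
    and \<pi> :: "rat \<Rightarrow> 'u \<Rightarrow> (rat \<Rightarrow> 'k) \<Rightarrow> rat \<Rightarrow> 'k"
    and \<Pi> :: "rat \<Rightarrow> rat \<Rightarrow> 'c \<Rightarrow> (rat \<times> rat \<Rightarrow> 'k) \<Rightarrow> rat \<times> rat \<Rightarrow> 'k" +
  assumes D_in_G: "j \<in> spins \<Longrightarrow> m' \<in> weights j \<Longrightarrow> m \<in> weights j \<Longrightarrow>
    \<exists>a. has_formal_sum coeff (D_terms scaleG x X \<pi> j m' m) a"
begin

abbreviation D where "D \<equiv> D_function scaleG coeff x X \<pi>"

context
  fixes j1 j2 m1 m2 k1 k2 :: rat
  assumes spins: "j1 \<in> spins" "j2 \<in> spins"
    and m: "m1 \<in> weights j1" "m2 \<in> weights j2"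
    and k: "k1 \<in> weights j1" "k2 \<in> weights j2"
begin

interpretation tensor: fin_rep scaleC "weights j1 \<times> weights j2" "\<Pi> j1 j2"
  using spins by (rule rep_tensor)

lemma coeff_D:
  "coeff (D j1 m1 k1) \<gamma> = matrix_element (\<pi> j1) m1 (X \<gamma>) k1"
  "coeff (D j2 m2 k2) \<gamma> = matrix_element (\<pi> j2) m2 (X \<gamma>) k2"
  using spins m k by (auto intro!: coeff_D_function D_in_G)

text \<open>The product of \<open>G\<close> is dual to the coproduct of \<open>g\<close>.\<close>

lemma coeff_D_mult:
  "coeff (D j1 m1 k1 * D j2 m2 k2) \<gamma> =
    matrix_element (\<Pi> j1 j2) (m1, m2) (\<Delta> (X \<gamma>)) (k1, k2)"
  unfolding \<Delta>_basis case_prod_beta using k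
  by (subst tensor.matrix_element_sum)
     (simp_all add: coeff_mult coeff_D matrix_element_tens spins case_prod_unfold)

text \<open>
  Here the first index of \<open>h\<close> belongs to the factor of spin \<open>j2\<close>, which sits in the second tensor
  slot of \<open>\<Pi> j1 j2\<close>; this interchange produces the opposite coproduct.
\<close>

lemma coeff_D_mult_swapped:
  "coeff (D j2 m2 k2 * D j1 m1 k1) \<gamma> =
    matrix_element (\<Pi> j1 j2) (m1, m2) (opposite_coproduct scaleU scaleC X h tens (X \<gamma>)) (k1, k2)"
  unfolding opposite_coproduct_basis case_prod_beta using k
  by (subst tensor.matrix_element_sum)
     (simp_all add: coeff_mult coeff_D matrix_element_tens spins case_prod_unfold mult_ac)

end

end

section \<open>The RTT relation\<close>

theorem theorem3p3:
  fixes scaleU :: "'k::field \<Rightarrow> 'u::ring_1 \<Rightarrow> 'u"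
    and scaleC :: "'k \<Rightarrow> 'c::ring_1 \<Rightarrow> 'c"
    and scaleG :: "'k \<Rightarrow> 'g::ring_1 \<Rightarrow> 'g"
    and X :: "'i \<Rightarrow> 'u" and x :: "'i \<Rightarrow> 'g"
    and f h :: "'i \<Rightarrow> 'i \<Rightarrow> 'i \<Rightarrow> 'k"
    and tens :: "'u \<Rightarrow> 'u \<Rightarrow> 'c"
    and \<Delta> :: "'u \<Rightarrow> 'c" and \<epsilon> :: "'u \<Rightarrow> 'k" and S :: "'u \<Rightarrow> 'u"
    and coeff :: "'g \<Rightarrow> 'i \<Rightarrow> 'k"
    and \<Delta>G :: "'g \<Rightarrow> 'i \<Rightarrow> 'i \<Rightarrow> 'k" and \<epsilon>G :: "'g \<Rightarrow> 'k" and SG :: "'g \<Rightarrow> 'g"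
    and \<pi> :: "rat \<Rightarrow> 'u \<Rightarrow> (rat \<Rightarrow> 'k) \<Rightarrow> rat \<Rightarrow> 'k"
    and \<Pi> :: "rat \<Rightarrow> rat \<Rightarrow> 'c \<Rightarrow> (rat \<times> rat \<Rightarrow> 'k) \<Rightarrow> rat \<times> rat \<Rightarrow> 'k"
    and R :: 'c
    and j1 j2 m1 m2 k1 k2 :: rat
  defines "\<D> \<equiv> D_function scaleG coeff x X \<pi>"
    and "Rm \<equiv> R_matrix \<Pi> R j1 j2"
  assumes duality:
      "hopf_algebras_in_duality scaleU scaleC X f h tens \<Delta> \<epsilon> S scaleG x coeff \<Delta>G \<epsilon>G SG"
    and reps: "spin_representations scaleU scaleC tens \<Delta> \<pi> \<Pi>"
    and D_in_G: "\<And>j m' m. j \<in> spins \<Longrightarrow> m' \<in> weights j \<Longrightarrow> m \<in> weights j \<Longrightarrow>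
      \<exists>a. has_formal_sum coeff (D_terms scaleG x X \<pi> j m' m) a"
    and R: "universal_R_matrix scaleU scaleC X h tens \<Delta> R"
    and spins: "j1 \<in> spins" "j2 \<in> spins"
    and m: "m1 \<in> weights j1" "m2 \<in> weights j2"
    and k: "k1 \<in> weights j1" "k2 \<in> weights j2"
  shows "(\<Sum>s1\<in>weights j1. \<Sum>s2\<in>weights j2.
            scaleG (Rm m1 m2 s1 s2) (\<D> j1 s1 k1 * \<D> j2 s2 k2)) =
         (\<Sum>s1\<in>weights j1. \<Sum>s2\<in>weights j2.
            scaleG (Rm s1 s2 k1 k2) (\<D> j2 m2 s2 * \<D> j1 m1 s1))"
proof -
  interpret hopf_algebras_in_duality scaleU scaleC X f h tens \<Delta> \<epsilon> S scaleG x coeff \<Delta>G \<epsilon>G SG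
    by (rule duality)
  interpret spin_representations scaleU scaleC tens \<Delta> \<pi> \<Pi>
    by (rule reps)
  interpret spin_representations_in_duality
    scaleU scaleC X f h tens \<Delta> \<epsilon> S scaleG x coeff \<Delta>G \<epsilon>G SG \<pi> \<Pi>
    by unfold_locales (rule D_in_G)
  interpret tensor: fin_rep scaleC "weights j1 \<times> weights j2" "\<Pi> j1 j2"
    using spins by (rule rep_tensor)
  let ?M = "matrix_element (\<Pi> j1 j2)" and ?B = "weights j1 \<times> weights j2"
  let ?\<Delta>' = "opposite_coproduct scaleU scaleC X h tens"
  have kk: "(k1, k2) \<in> ?B" using k by simp
  let ?L = "\<Sum>s1\<in>weights j1. \<Sum>s2\<in>weights j2.
    scaleG (Rm m1 m2 s1 s2) (\<D> j1 s1 k1 * \<D> j2 s2 k2)"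
  let ?R = "\<Sum>s1\<in>weights j1. \<Sum>s2\<in>weights j2.
    scaleG (Rm s1 s2 k1 k2) (\<D> j2 m2 s2 * \<D> j1 m1 s1)"
  have "coeff ?L \<gamma> = coeff ?R \<gamma>" for \<gamma>
  proof -
    have "coeff ?L \<gamma> =
        (\<Sum>(s1, s2)\<in>?B. Rm m1 m2 s1 s2 * coeff (\<D> j1 s1 k1 * \<D> j2 s2 k2) \<gamma>)"
      by (simp add: sum.cartesian_product case_prod_beta coeff_sum)
    also have "\<dots> = (\<Sum>s\<in>?B. ?M (m1, m2) R s * ?M s (\<Delta> (X \<gamma>)) (k1, k2))"
      using spins k by (intro sum.cong) (auto simp: \<D>_def Rm_def R_matrix_def coeff_D_mult)
    also have "\<dots> = ?M (m1, m2) (R * \<Delta> (X \<gamma>)) (k1, k2)"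
      by (rule tensor.matrix_element_mult[OF kk, symmetric])
    also have "\<dots> = ?M (m1, m2) (?\<Delta>' (X \<gamma>) * R) (k1, k2)"
      by (simp add: universal_R_matrix_intertwines[OF R])
    also have "\<dots> = (\<Sum>s\<in>?B. ?M (m1, m2) (?\<Delta>' (X \<gamma>)) s * ?M s R (k1, k2))"
      by (rule tensor.matrix_element_mult[OF kk])
    also have "\<dots> = (\<Sum>(s1, s2)\<in>?B. Rm s1 s2 k1 k2 * coeff (\<D> j2 m2 s2 * \<D> j1 m1 s1) \<gamma>)"
      using spins m
      by (intro sum.cong) (auto simp: \<D>_def Rm_def R_matrix_def coeff_D_mult_swapped)
    also have "\<dots> = coeff ?R \<gamma>"
      by (simp add: sum.cartesian_product case_prod_beta coeff_sum)
    finally show ?thesis .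
  qed
  then show ?thesis by (intro injD[OF coeff_inj] ext)
qed

end
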